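(* If $A_m=(a_{ij})$ is an extreme point of $\mathbf{U}_m$, then $a_{ii}\in\{0,1\}$ for every $i\in I_m$ and $a_{ij}\in\{0,\tfrac12,1\}$ for all $i\neq j$ in $I_m$. In other words, $\mathrm{Extr}\,\mathbf{U}_m\subset\mathbf{U}_m^{(0,\frac12,1)}$.
   Context: $I_m=\{1,\dots,m\}$. $\mathbf{U}_m$ is the set of real $m\times m$ matrices $A_m=(a_{ij})$ with $a_{ij}=a_{ji}\ge 0$ for all $i,j$ and $\sum_{i,j\in\alpha}a_{ij}\le|\alpha|$ for every $\alpha\subset I_m$ ($|\alpha|$ the cardinality). $\mathbf{U}_m^{(0,\frac12,1)}=\{A_m\in\mathbf{U}_m:\ a_{ii}\in\{0,1\},\ a_{ij}\in\{0,\tfrac12,1\}\ \forall i,j\}$. $\mathrm{Extr}$ denotes the set of extreme points. *)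

theory Defs
  imports "HOL-Analysis.Analysis"
begin

text \<open>
  The index set \<open>I\<^sub>m\<close> is the universe of a finite type \<open>'m\<close>, with \<open>m = CARD('m) \<ge> 1\<close>
  arbitrary. Sums run over ordered pairs of indices, so each off-diagonal entry
  is counted twice.
\<close>

definition U_mat :: "(real ^ 'm ^ 'm) set" where
  "U_mat = {A. (\<forall>i j. A $ i $ j = A $ j $ i \<and> 0 \<le> A $ i $ j) \<and>
               (\<forall>\<alpha> :: 'm set. (\<Sum>i\<in>\<alpha>. \<Sum>j\<in>\<alpha>. A $ i $ j) \<le> real (card \<alpha>))}"

definition U_mat_half :: "(real ^ 'm ^ 'm) set" where
  "U_mat_half = {A \<in> U_mat. (\<forall>i. A $ i $ i \<in> {0, 1}) \<and> (\<forall>i j. A $ i $ j \<in> {0, 1/2, 1})}"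

definition Extr :: "'a::real_vector set \<Rightarrow> 'a set" where
  "Extr S = {x. x extreme_point_of S}"

end

theory Submission imports Defs begin

text \<open>
  Give the edge (or loop) \<open>{i, j}\<close> the weight \<open>a\<^sub>i\<^sub>i\<close> if \<open>i = j\<close> and \<open>2 a\<^sub>i\<^sub>j\<close> otherwise, so that the
  constraint for \<open>\<alpha>\<close> bounds the total weight of the edges inside \<open>\<alpha>\<close>; the claim becomes that all
  weights are integers. The weight inside \<open>\<alpha>\<close> is supermodular in \<open>\<alpha>\<close>, so the tight sets are closed
  under intersection. Let \<open>e\<close> be an edge of fractional weight. If no tight set contains a fractional
  edge, the weight of \<open>e\<close> alone can be moved in both directions. Otherwise take a tight set \<open>\<alpha>\<close> of
  least cardinality containing a fractional edge \<open>e\<close>. As the weight inside \<open>\<alpha>\<close> is the integer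
  \<open>|\<alpha>|\<close>, there is a second fractional edge \<open>f\<close> in \<open>\<alpha>\<close>; by minimality every tight set containing
  \<open>e\<close> or \<open>f\<close> contains \<open>\<alpha>\<close>, so weight can be shifted between \<open>e\<close> and \<open>f\<close>.
\<close>

section \<open>Block sums and edge weights\<close>

definition block_sum :: "real ^ 'm ^ 'm \<Rightarrow> 'm set \<Rightarrow> real" where
  "block_sum A \<alpha> = (\<Sum>i\<in>\<alpha>. \<Sum>j\<in>\<alpha>. A $ i $ j)"

definition edge_weight :: "real ^ 'm ^ 'm \<Rightarrow> 'm \<Rightarrow> 'm \<Rightarrow> real" where
  "edge_weight A i j = (if i = j then A $ i $ j else 2 * A $ i $ j)"

text \<open>Averaging the two indicators covers loops as well: for \<open>i = j\<close> they
  coincide and give one entry 1, otherwise there are two entries 1/2. Either way the edge {i, j}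
  gets weight 1 and every other edge 0.\<close>

definition edge_matrix :: "'m \<Rightarrow> 'm \<Rightarrow> real ^ 'm ^ 'm" where
  "edge_matrix i j = (\<chi> k l. (of_bool (k = i \<and> l = j) + of_bool (k = j \<and> l = i)) / 2)"

definition tight :: "real ^ 'm ^ 'm \<Rightarrow> 'm set \<Rightarrow> bool" where
  "tight A \<alpha> \<longleftrightarrow> block_sum A \<alpha> = real (card \<alpha>)"

lemma U_mat_iff:
  "A \<in> U_mat \<longleftrightarrow> (\<forall>i j. A $ i $ j = A $ j $ i) \<and> (\<forall>i j. 0 \<le> A $ i $ j) \<and>
     (\<forall>\<alpha>. block_sum A \<alpha> \<le> real (card \<alpha>))"
  unfolding U_mat_def block_sum_def by blast

lemma block_sum_add: "block_sum (A + B) \<alpha> = block_sum A \<alpha> + block_sum B \<alpha>"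
  by (simp add: block_sum_def sum.distrib)

lemma block_sum_diff: "block_sum (A - B) \<alpha> = block_sum A \<alpha> - block_sum B \<alpha>"
  by (simp add: block_sum_def sum_subtractf)

lemma block_sum_scaleR: "block_sum (c *\<^sub>R A) \<alpha> = c * block_sum A \<alpha>"
  by (simp add: block_sum_def sum_distrib_left)

lemma block_sum_edge_matrix:
  fixes i j :: "'m::finite"
  shows "block_sum (edge_matrix i j) \<alpha> = of_bool (i \<in> \<alpha> \<and> j \<in> \<alpha>)"
proof -
  have *: "(\<Sum>k\<in>\<alpha>. \<Sum>l\<in>\<alpha>. of_bool (k = a \<and> l = b) / 2) = (of_bool (a \<in> \<alpha> \<and> b \<in> \<alpha>) / 2 :: real)"
    for a b :: 'm
  proof -
    have "(\<Sum>k\<in>\<alpha>. \<Sum>l\<in>\<alpha>. of_bool (k = a \<and> l = b) / 2 :: real)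
        = (\<Sum>k\<in>\<alpha>. if k = a then (if b \<in> \<alpha> then 1 / 2 else 0) else 0)"
      by (intro sum.cong refl) (auto simp: of_bool_def if_distrib[of "\<lambda>x. x / 2"] cong: if_cong)
    then show ?thesis by (simp add: sum.delta)
  qed
  show ?thesis
    by (auto simp: block_sum_def edge_matrix_def add_divide_distrib sum.distrib *)
qed

lemma edge_matrix_nth:
  "edge_matrix i j $ k $ l = (of_bool (k = i \<and> l = j) + of_bool (k = j \<and> l = i)) / 2"
  by (simp add: edge_matrix_def)

lemma edge_matrix_sym: "edge_matrix i j $ k $ l = edge_matrix i j $ l $ k"
  by (simp add: edge_matrix_nth conj_commute add.commute)

lemma edge_matrix_eq_0:
  assumes "A $ i $ j \<noteq> 0" "A $ j $ i \<noteq> 0" "A $ k $ l = 0"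
  shows "edge_matrix i j $ k $ l = 0"
proof -
  have "\<not> (k = i \<and> l = j)" "\<not> (k = j \<and> l = i)"
    using assms by metis+
  then show ?thesis
    unfolding edge_matrix_nth by (simp only: simp_thms of_bool_eq add_0 div_0)
qed

lemma edge_weight_edge_matrix:
  "edge_weight (edge_matrix i j) k l = of_bool ({k, l} = {i, j})"
  by (auto simp: edge_weight_def edge_matrix_nth doubleton_eq_iff)

lemma edge_weight_diff_scaleR:
  "edge_weight (A - c *\<^sub>R B) i j = edge_weight A i j - c * edge_weight B i j"
  by (simp add: edge_weight_def algebra_simps)

text \<open>Enlarging \<open>F\<close> by \<open>x\<close> adds the loop at \<open>x\<close> and the
  edges from \<open>x\<close> to \<open>F\<close>. By symmetry the entries at (x, k) and (k, x)
  together make up one edge weight.\<close>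

lemma block_sum_Ints:
  fixes A :: "real ^ 'm ^ 'm"
  assumes sym: "\<And>k l. A $ k $ l = A $ l $ k"
    and int: "\<And>k l. k \<in> \<alpha> \<Longrightarrow> l \<in> \<alpha> \<Longrightarrow> edge_weight A k l \<in> \<int>"
  shows "block_sum A \<alpha> \<in> \<int>"
  using finite[of \<alpha>] int
proof (induction \<alpha> rule: finite_induct)
  case empty
  then show ?case by (simp add: block_sum_def)
next
  case (insert x F)
  have eq: "block_sum A (insert x F) = edge_weight A x x + (\<Sum>k\<in>F. edge_weight A x k) + block_sum A F"
  proof -
    have "(\<Sum>k\<in>F. edge_weight A x k) = (\<Sum>k\<in>F. A $ x $ k) + (\<Sum>k\<in>F. A $ k $ x)"
      using insert.hyps by (auto simp: edge_weight_def sym[of _ x] sum.distrib[symmetric] intro!: sum.cong)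
    then show ?thesis
      using insert.hyps by (simp add: block_sum_def sum.distrib edge_weight_def)
  qed
  show ?case
    unfolding eq using insert by (intro Ints_add Ints_sum) auto
qed

section \<open>Supermodularity and tight sets\<close>

lemma block_sum_supermodular:
  fixes A :: "real ^ 'm ^ 'm"
  assumes "\<And>i j. 0 \<le> A $ i $ j"
  shows "block_sum A \<alpha> + block_sum A \<beta> \<le> block_sum A (\<alpha> \<union> \<beta>) + block_sum A (\<alpha> \<inter> \<beta>)"
proof -
  let ?f = "\<lambda>(i, j). A $ i $ j"
  have bs: "block_sum A \<gamma> = sum ?f (\<gamma> \<times> \<gamma>)" for \<gamma>
    by (simp add: block_sum_def sum.cartesian_product)
  have "sum ?f (\<alpha> \<times> \<alpha>) + sum ?f (\<beta> \<times> \<beta>)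
      = sum ?f (\<alpha> \<times> \<alpha> \<union> \<beta> \<times> \<beta>) + sum ?f ((\<alpha> \<times> \<alpha>) \<inter> (\<beta> \<times> \<beta>))"
    by (rule sum.union_inter[symmetric]) auto
  also have "(\<alpha> \<times> \<alpha>) \<inter> (\<beta> \<times> \<beta>) = (\<alpha> \<inter> \<beta>) \<times> (\<alpha> \<inter> \<beta>)" by auto
  \<comment> \<open>The additional pairs join \<alpha> - \<beta> to \<beta> - \<alpha>, and their
    entries are nonnegative.\<close>
  also have "sum ?f (\<alpha> \<times> \<alpha> \<union> \<beta> \<times> \<beta>) \<le> sum ?f ((\<alpha> \<union> \<beta>) \<times> (\<alpha> \<union> \<beta>))"
    by (rule sum_mono2) (auto simp: assms)
  finally show ?thesis by (simp add: bs)
qed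

text \<open>Cardinality is modular, so supermodularity and the constraints for the union and the
  intersection leave no slack in either of them.\<close>

lemma tight_Int:
  assumes "A \<in> U_mat" "tight A \<alpha>" "tight A \<beta>"
  shows "tight A (\<alpha> \<inter> \<beta>)"
proof -
  have "block_sum A (\<alpha> \<union> \<beta>) \<le> real (card (\<alpha> \<union> \<beta>))"
    "block_sum A (\<alpha> \<inter> \<beta>) \<le> real (card (\<alpha> \<inter> \<beta>))"
    "block_sum A \<alpha> + block_sum A \<beta> \<le> block_sum A (\<alpha> \<union> \<beta>) + block_sum A (\<alpha> \<inter> \<beta>)"
    using assms(1) by (auto simp: U_mat_iff intro: block_sum_supermodular)
  moreover have "real (card \<alpha>) + real (card \<beta>) = real (card (\<alpha> \<union> \<beta>)) + real (card (\<alpha> \<inter> \<beta>))"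
    using card_Un_Int[of \<alpha> \<beta>] by (simp flip: of_nat_add)
  ultimately show ?thesis
    using assms(2,3) by (simp add: tight_def)
qed

lemma tight_another_fractional:
  assumes "A \<in> U_mat" "tight A \<alpha>" "i \<in> \<alpha>" "j \<in> \<alpha>" "edge_weight A i j \<notin> \<int>"
  obtains (other) k l where "k \<in> \<alpha>" "l \<in> \<alpha>" "{k, l} \<noteq> {i, j}" "edge_weight A k l \<notin> \<int>"
proof (rule ccontr)
  assume contra: "\<not> thesis"
  have int: "edge_weight A k l \<in> \<int>" if "k \<in> \<alpha>" "l \<in> \<alpha>" "{k, l} \<noteq> {i, j}" for k l
    using contra other[OF that] by blast
  have sym: "A $ k $ l = A $ l $ k" for k l
    using assms(1) by (auto simp: U_mat_iff)
  \<comment> \<open>\<open>?B\<close> is \<open>A\<close> with the weight of the edge {i, j} set to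
    0, so under the contrary assumption all its weights inside \<alpha> are integers.\<close>
  let ?B = "A - edge_weight A i j *\<^sub>R edge_matrix i j"
  have "block_sum ?B \<alpha> \<in> \<int>"
  proof (rule block_sum_Ints)
    show "?B $ k $ l = ?B $ l $ k" for k l
      using sym[of k l] by (simp add: edge_matrix_sym[of i j k l])
    show "edge_weight ?B k l \<in> \<int>" if "k \<in> \<alpha>" "l \<in> \<alpha>" for k l
    proof (cases "{k, l} = {i, j}")
      case True
      then have "edge_weight A k l = edge_weight A i j"
        by (auto simp: doubleton_eq_iff edge_weight_def sym)
      with True show ?thesis
        by (simp add: edge_weight_diff_scaleR edge_weight_edge_matrix)
    next
      case False
      with int that show ?thesis
        by (simp add: edge_weight_diff_scaleR edge_weight_edge_matrix)
    qed
  qed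
  moreover have "block_sum ?B \<alpha> = real (card \<alpha>) - edge_weight A i j"
    using assms by (simp add: block_sum_diff block_sum_scaleR block_sum_edge_matrix tight_def)
  ultimately have "real (card \<alpha>) - (real (card \<alpha>) - edge_weight A i j) \<in> \<int>"
    by (intro Ints_diff) auto
  with assms(5) show False by simp
qed

section \<open>Perturbing an extreme point\<close>

lemma eventually_nonneg_perturbation:
  fixes a b :: real
  assumes "0 \<le> a" "a = 0 \<Longrightarrow> b = 0"
  shows "\<forall>\<^sub>F t in nhds 0. 0 \<le> a + t * b"
proof (cases "a = 0")
  case False
  have "((\<lambda>t. a + t * b) \<longlongrightarrow> a + 0 * b) (nhds 0)"
    by (intro tendsto_intros filterlim_ident)
  then have "\<forall>\<^sub>F t in nhds 0. 0 < a + t * b"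
    by (rule order_tendstoD) (use False assms in auto)
  then show ?thesis by (rule eventually_mono) simp
qed (use assms in simp)

text \<open>The constraints are finite in number. Those active at \<open>A\<close> (zero entries and
  tight sets) do not change along \<open>D\<close>, and the others survive small steps. Hence
  \<open>A\<close> could be moved both ways along a nonzero \<open>D\<close>.\<close>

lemma extreme_point_no_perturbation:
  fixes A D :: "real ^ 'm ^ 'm"
  assumes ext: "A extreme_point_of U_mat"
    and sym: "\<And>k l. D $ k $ l = D $ l $ k"
    and supp: "\<And>k l. A $ k $ l = 0 \<Longrightarrow> D $ k $ l = 0"
    and tight: "\<And>\<alpha>. tight A \<alpha> \<Longrightarrow> block_sum D \<alpha> = 0"
  shows "D = 0"
proof (rule ccontr)
  assume "D \<noteq> 0"
  have A: "A \<in> U_mat"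
    using ext by (simp add: extreme_point_of_def)
  have "\<forall>\<^sub>F t in nhds 0. \<forall>k l. 0 \<le> A $ k $ l + t * D $ k $ l"
    using A supp by (intro eventually_all_finite eventually_nonneg_perturbation) (auto simp: U_mat_iff)
  \<comment> \<open>The slack of each cardinality constraint, as an affine function of
    \<open>t\<close>; a slack of 0 means that the set is tight.\<close>
  moreover have "\<forall>\<^sub>F t in nhds 0. \<forall>\<alpha>. 0 \<le> (real (card \<alpha>) - block_sum A \<alpha>) + t * (- block_sum D \<alpha>)"
    using A tight
    by (intro eventually_all_finite eventually_nonneg_perturbation) (auto simp: U_mat_iff tight_def)
  ultimately have "\<forall>\<^sub>F t in nhds 0. A + t *\<^sub>R D \<in> U_mat"
  proof eventually_elim
    case (elim t)
    then show ?case
      using A by (auto simp: U_mat_iff sym block_sum_add block_sum_scaleR algebra_simps)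
  qed
  then obtain d where d: "d > 0" "\<And>t. \<bar>t\<bar> < d \<Longrightarrow> A + t *\<^sub>R D \<in> U_mat"
    by (auto simp: eventually_nhds_metric dist_real_def)
  let ?X = "A + (d / 2) *\<^sub>R D" and ?Y = "A + (- d / 2) *\<^sub>R D"
  have "?X \<in> U_mat" "?Y \<in> U_mat"
    using d(1) by (auto intro!: d(2) simp del: scaleR_minus_left)
  moreover have "A = midpoint ?X ?Y"
    by (simp add: midpoint_def vec_eq_iff)
  moreover have "?X \<noteq> ?Y"
    using \<open>D \<noteq> 0\<close> d(1) by (simp add: vec_eq_iff)
  ultimately show False
    using ext midpoint_in_open_segment[of ?X ?Y] by (auto simp: extreme_point_of_def)
qed

lemma extreme_point_edge_weight_Ints:
  fixes A :: "real ^ 'm ^ 'm"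
  assumes ext: "A extreme_point_of U_mat"
  shows "edge_weight A i j \<in> \<int>"
proof (rule ccontr)
  assume ij: "edge_weight A i j \<notin> \<int>"
  have A: "A \<in> U_mat"
    using ext by (simp add: extreme_point_of_def)
  then have sym: "A $ k $ l = A $ l $ k" for k l
    by (auto simp: U_mat_iff)
  have nz: "A $ k $ l \<noteq> 0" if "edge_weight A k l \<notin> \<int>" for k l
    using that by (auto simp: edge_weight_def split: if_splits)
  define P where "P = (\<lambda>(\<alpha>, k, l). tight A \<alpha> \<and> k \<in> \<alpha> \<and> l \<in> \<alpha> \<and> edge_weight A k l \<notin> \<int>)"
  show False
  proof (cases "\<exists>x. P x")
    case False
    \<comment> \<open>No tight set contains both \<open>i\<close> and \<open>j\<close>, so this
      direction is admissible.\<close>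
    have "edge_matrix i j = 0"
    proof (rule extreme_point_no_perturbation[OF ext])
      show "block_sum (edge_matrix i j) \<alpha> = 0" if "tight A \<alpha>" for \<alpha>
        using False that ij by (auto simp: P_def block_sum_edge_matrix)
      show "edge_matrix i j $ k $ l = 0" if "A $ k $ l = 0" for k l
        using edge_matrix_eq_0 nz[OF ij] sym that by metis
    qed (rule edge_matrix_sym)
    then show False
      using edge_weight_edge_matrix[of i j i j] by (simp add: edge_weight_def split: if_splits)
  next
    case True
    then obtain x where x: "P x" "\<And>y. P y \<Longrightarrow> card (fst x) \<le> card (fst y)"
      using exists_least_iff[of "\<lambda>n. \<exists>x. P x \<and> card (fst x) = n"] by (metis not_le)
    obtain \<alpha> p q where [simp]: "x = (\<alpha>, p, q)" by (cases x) auto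
    have pq: "tight A \<alpha>" "p \<in> \<alpha>" "q \<in> \<alpha>" "edge_weight A p q \<notin> \<int>"
      using x(1) by (auto simp: P_def)
    obtain r s where rs: "r \<in> \<alpha>" "s \<in> \<alpha>" "{r, s} \<noteq> {p, q}" "edge_weight A r s \<notin> \<int>"
      using tight_another_fractional[OF A pq] by metis
    \<comment> \<open>The set \<alpha> \<inter> \<beta> is tight and contains a fractional edge, so
      it cannot be smaller than \<alpha>.\<close>
    have min: "\<alpha> \<subseteq> \<beta>"
      if "tight A \<beta>" "k \<in> \<alpha>" "l \<in> \<alpha>" "k \<in> \<beta>" "l \<in> \<beta>" "edge_weight A k l \<notin> \<int>" for \<beta> k l
    proof -
      have "P (\<alpha> \<inter> \<beta>, k, l)"
        using that pq tight_Int[OF A] by (auto simp: P_def)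
      from x(2)[OF this] have "\<alpha> \<inter> \<beta> = \<alpha>"
        by (intro card_subset_eq) (auto intro!: le_antisym card_mono)
      then show ?thesis by blast
    qed
    \<comment> \<open>A tight set either includes \<alpha>, and then the two edges cancel, or
      contains neither edge.\<close>
    let ?D = "edge_matrix p q - edge_matrix r s"
    have "?D = 0"
    proof (rule extreme_point_no_perturbation[OF ext])
      show "block_sum ?D \<beta> = 0" if "tight A \<beta>" for \<beta>
        using min[OF that pq(2,3) _ _ pq(4)] min[OF that rs(1,2) _ _ rs(4)] pq rs
        by (auto simp: block_sum_diff block_sum_edge_matrix)
      show "?D $ k $ l = 0" if "A $ k $ l = 0" for k l
      proof -
        have "edge_matrix p q $ k $ l = 0" "edge_matrix r s $ k $ l = 0"
          using edge_matrix_eq_0 nz[OF pq(4)] nz[OF rs(4)] sym that by metis+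
        then show ?thesis by simp
      qed
      show "?D $ k $ l = ?D $ l $ k" for k l
        by (simp add: edge_matrix_sym[of _ _ k l])
    qed
    then have "edge_matrix p q = (edge_matrix r s :: real ^ 'm ^ 'm)"
      by simp
    then show False
      using edge_weight_edge_matrix[of p q r s] edge_weight_edge_matrix[of r s r s] rs(3)
      by simp
  qed
qed

section \<open>From integral weights to entries\<close>

lemma U_mat_edge_weight_bounds:
  assumes "A \<in> U_mat"
  shows "0 \<le> edge_weight A i j" "edge_weight A i j \<le> real (card {i, j})"
proof -
  have nonneg: "\<And>k l. 0 \<le> A $ k $ l" and sym: "A $ i $ j = A $ j $ i"
    and le: "block_sum A {i, j} \<le> real (card {i, j})"
    using assms by (auto simp: U_mat_iff)
  show "0 \<le> edge_weight A i j"
    using nonneg by (simp add: edge_weight_def)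
  show "edge_weight A i j \<le> real (card {i, j})"
    \<comment> \<open>For distinct indices the block sum is the edge weight plus two nonnegative
      diagonal entries.\<close>
    using le sym nonneg[of i i] nonneg[of j j]
    by (cases "i = j") (auto simp: edge_weight_def block_sum_def)
qed

lemma extreme_point_entries:
  assumes "A extreme_point_of U_mat"
  shows "A $ i $ i \<in> {0, 1}" "i \<noteq> j \<Longrightarrow> A $ i $ j \<in> {0, 1/2, 1}"
proof -
  have A: "A \<in> U_mat"
    using assms by (simp add: extreme_point_of_def)
  obtain z where z: "edge_weight A i i = of_int z"
    using extreme_point_edge_weight_Ints[OF assms] by (metis Ints_cases)
  then have "z \<in> {0..1}"
    using U_mat_edge_weight_bounds[OF A, of i i] by simp
  then have "z = 0 \<or> z = 1" by auto
  with z show "A $ i $ i \<in> {0, 1}"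
    by (auto simp: edge_weight_def)
  assume ne: "i \<noteq> j"
  obtain w where w: "edge_weight A i j = of_int w"
    using extreme_point_edge_weight_Ints[OF assms] by (metis Ints_cases)
  \<comment> \<open>The set {i, j} has two elements, and \<open>w\<close> is twice the entry; this
    is where the value 1/2 comes from.\<close>
  then have "w \<in> {0..2}"
    using U_mat_edge_weight_bounds[OF A, of i j] ne by simp
  then have "w = 0 \<or> w = 1 \<or> w = 2" by auto
  with w ne show "A $ i $ j \<in> {0, 1/2, 1}"
    by (auto simp: edge_weight_def)
qed

theorem theorem3p2:
  shows "(\<forall>A :: real ^ 'm ^ 'm. A \<in> Extr U_mat \<longrightarrow>
            (\<forall>i. A $ i $ i \<in> {0, 1}) \<and>
            (\<forall>i j. i \<noteq> j \<longrightarrow> A $ i $ j \<in> {0, 1/2, 1}))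
         \<and> Extr (U_mat :: (real ^ 'm ^ 'm) set) \<subseteq> U_mat_half"
proof -
  have diag: "A $ i $ i \<in> {0, 1}" and off: "i \<noteq> j \<Longrightarrow> A $ i $ j \<in> {0, 1/2, 1}"
    if "A \<in> Extr U_mat" for A :: "real ^ 'm ^ 'm" and i j
    using extreme_point_entries[of A] that by (simp_all add: Extr_def)
  have "A \<in> U_mat_half" if "A \<in> Extr U_mat" for A :: "real ^ 'm ^ 'm"
  proof -
    have "A $ i $ j \<in> {0, 1/2, 1}" for i j
      using diag[OF that, of i] off[OF that, of i j] by (cases "i = j") auto
    then show ?thesis
      using that diag[OF that] by (simp add: U_mat_half_def Extr_def extreme_point_of_def)
  qed
  with diag off show ?thesis by (intro conjI allI impI subsetI) assumption+
qed

end
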